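(* Let $\mathbb{K}$ be an algebraically closed field of characteristic zero and let $n$ be a positive integer. Let $D_1,\ldots,D_s$ be a finite collection of triangular derivations of the polynomial algebra $\mathbb{K}[x_1,\ldots,x_n]$. Then the Lie subalgebra of $\mathrm{Der}(\mathbb{K}[x_1,\ldots,x_n])$ generated by $D_1,\ldots,D_s$ is a finite-dimensional nilpotent Lie algebra.
   Context: $\mathrm{Der}(\mathbb{K}[x_1,\ldots,x_n])$ is the Lie algebra of all $\mathbb{K}$-linear derivations of $\mathbb{K}[x_1,\ldots,x_n]$ with bracket $[D,D']=DD'-D'D$. Every such derivation has the form $D=g_1\frac{\partial}{\partial x_1}+\ldots+g_n\frac{\partial}{\partial x_n}$ with $g_1,\ldots,g_n\in\mathbb{K}[x_1,\ldots,x_n]$. The derivation $D$ is triangular if $g_i\in\mathbb{K}[x_1,\ldots,x_{i-1}]$ for all $i=2,\ldots,n$ and $g_1\in\mathbb{K}$. *)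

theory Defs
  imports
    "HOL-Library.Poly_Mapping"
    "HOL-Library.Function_Algebras"
    "HOL-Computational_Algebra.Polynomial"
begin

text \<open>
  Polynomials over \<open>'k\<close> are the monoid algebra of the monomials \<open>'n \<Rightarrow>\<^sub>0 nat\<close>. The dimension
  \<open>n\<close> is the type \<open>'n\<close>: for \<open>'n\<close> finite and linearly ordered with \<open>CARD('n) = n\<close>, the variables
  \<open>x\<^sub>1, \<dots>, x\<^sub>n\<close> are the elements of \<open>'n\<close> in increasing order.
\<close>

type_synonym ('n, 'k) mpoly = "('n \<Rightarrow>\<^sub>0 nat) \<Rightarrow>\<^sub>0 'k"

definition mvar :: "'n \<Rightarrow> ('n, 'k::zero_neq_one) mpoly" where
  "mvar i = Poly_Mapping.single (Poly_Mapping.single i 1) 1"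

definition mscale :: "'k \<Rightarrow> ('n, 'k) mpoly \<Rightarrow> ('n, 'k::field) mpoly" where
  "mscale c p = Poly_Mapping.single 0 c * p"

text \<open>\<open>polys_in J\<close> is the subalgebra of polynomials in the variables from \<open>J\<close> only;
  \<open>polys_in {}\<close> consists of the constants.\<close>

definition polys_in :: "'n set \<Rightarrow> ('n, 'k::zero) mpoly set" where
  "polys_in J = {p. \<forall>m\<in>Poly_Mapping.keys p. Poly_Mapping.keys m \<subseteq> J}"

text \<open>If \<open>x\<^sub>i\<close> does not occur in \<open>m\<close>, the subtraction below is truncated, but then the coefficient
  is zero.\<close>

definition mpartial :: "'n \<Rightarrow> ('n, 'k) mpoly \<Rightarrow> ('n, 'k::comm_ring_1) mpoly" where
  "mpartial i p = (\<Sum>m\<in>Poly_Mapping.keys p.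
     Poly_Mapping.single (m - Poly_Mapping.single i 1)
       (of_nat (Poly_Mapping.lookup m i) * Poly_Mapping.lookup p m))"

interpretation mpoly: vector_space mscale
  by unfold_locales
    (simp_all add: mscale_def distrib_left distrib_right single_add mult_single flip: mult.assoc)

text \<open>Sums and differences of maps are pointwise.\<close>

definition der_scale ::
    "'k \<Rightarrow> (('n, 'k) mpoly \<Rightarrow> ('n, 'k) mpoly) \<Rightarrow> ('n, 'k::field) mpoly \<Rightarrow> ('n, 'k) mpoly" where
  "der_scale c D = (\<lambda>p. mscale c (D p))"

interpretation der: vector_space der_scale
  by unfold_locales (simp_all add: der_scale_def fun_eq_iff mpoly.scale_right_distrib
    mpoly.scale_left_distrib)

definition Der :: "(('n, 'k::field) mpoly \<Rightarrow> ('n, 'k) mpoly) set" where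
  "Der = {D. Vector_Spaces.linear mscale mscale D \<and> (\<forall>p q. D (p * q) = D p * q + p * D q)}"

definition lie_bracket ::
    "(('n, 'k) mpoly \<Rightarrow> ('n, 'k) mpoly) \<Rightarrow> (('n, 'k) mpoly \<Rightarrow> ('n, 'k) mpoly) \<Rightarrow>
     ('n, 'k::field) mpoly \<Rightarrow> ('n, 'k) mpoly" where
  "lie_bracket D E = (D \<circ> E) - (E \<circ> D)"

definition lie_subalgebra :: "(('n, 'k::field) mpoly \<Rightarrow> ('n, 'k) mpoly) set \<Rightarrow> bool" where
  "lie_subalgebra L \<longleftrightarrow>
     L \<subseteq> Der \<and> der.subspace L \<and> (\<forall>D\<in>L. \<forall>E\<in>L. lie_bracket D E \<in> L)"

definition lie_generated ::
    "(('n, 'k::field) mpoly \<Rightarrow> ('n, 'k) mpoly) set \<Rightarrow> (('n, 'k) mpoly \<Rightarrow> ('n, 'k) mpoly) set" where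
  "lie_generated S = lie_subalgebra hull S"

definition lie_finite_dim :: "(('n, 'k::field) mpoly \<Rightarrow> ('n, 'k) mpoly) set \<Rightarrow> bool" where
  "lie_finite_dim L \<longleftrightarrow> (\<exists>B. finite B \<and> B \<subseteq> L \<and> der.span B = L)"

primrec lower_central ::
    "(('n, 'k::field) mpoly \<Rightarrow> ('n, 'k) mpoly) set \<Rightarrow> nat \<Rightarrow>
     (('n, 'k) mpoly \<Rightarrow> ('n, 'k) mpoly) set" where
  "lower_central L 0 = L"
| "lower_central L (Suc k) = der.span {lie_bracket D E |D E. D \<in> L \<and> E \<in> lower_central L k}"

definition lie_nilpotent :: "(('n, 'k::field) mpoly \<Rightarrow> ('n, 'k) mpoly) set \<Rightarrow> bool" where
  "lie_nilpotent L \<longleftrightarrow> (\<exists>k. lower_central L k = {0})"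

definition triangular ::
    "(('n::{finite,linorder}, 'k::field) mpoly \<Rightarrow> ('n, 'k) mpoly) \<Rightarrow> bool" where
  "triangular D \<longleftrightarrow>
     (\<exists>g. (\<forall>i. g i \<in> polys_in {..<i}) \<and> D = (\<lambda>p. \<Sum>i\<in>UNIV. g i * mpartial i p))"

lemma mpartial_superset:
  assumes "finite A" "Poly_Mapping.keys p \<subseteq> A"
  shows "mpartial i p = (\<Sum>m\<in>A. Poly_Mapping.single (m - Poly_Mapping.single i 1)
       (of_nat (Poly_Mapping.lookup m i) * Poly_Mapping.lookup p m))"
  unfolding mpartial_def using assms
  by (intro sum.mono_neutral_left) (auto simp: in_keys_iff)

lemma mpartial_zero [simp]: "mpartial i 0 = 0"
  by (simp add: mpartial_def)

lemma mpartial_add: "mpartial i (p + q) = mpartial i p + mpartial i q"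
proof -
  let ?A = "Poly_Mapping.keys p \<union> Poly_Mapping.keys q"
  have "Poly_Mapping.keys (p + q) \<subseteq> ?A" by (rule keys_add)
  then show ?thesis
    by (simp add: mpartial_superset[of ?A] lookup_add algebra_simps single_add sum.distrib)
qed

lemma mpartial_single:
  "mpartial i (Poly_Mapping.single m c) =
     Poly_Mapping.single (m - Poly_Mapping.single i 1) (of_nat (Poly_Mapping.lookup m i) * c)"
  by (subst mpartial_superset[of "{m}"]) auto

lemma mpartial_mvar: "mpartial i (mvar j) = (if i = j then 1 else 0)"
  by (simp add: mvar_def mpartial_single lookup_single when_def)

lemma mpoly_induct [case_names zero add]:
  fixes p :: "('n, 'k::comm_ring_1) mpoly"
  assumes "P 0" and "\<And>p m c. P p \<Longrightarrow> P (p + Poly_Mapping.single m c)"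
  shows "P p"
proof (induction p rule: update_induct)
  case const
  then show ?case by (rule assms)
next
  case (update f a b)
  have "Poly_Mapping.update a b f = f + Poly_Mapping.single a b"
    using update
    by (intro poly_mapping_eqI) (auto simp: lookup_update lookup_add lookup_single in_keys_iff when_def)
  then show ?case using update assms by simp
qed

lemma mpartial_mult_single:
  fixes c d :: "'k::comm_ring_1"
  shows "mpartial i (Poly_Mapping.single m c * Poly_Mapping.single m' d) =
    mpartial i (Poly_Mapping.single m c) * Poly_Mapping.single m' d +
    Poly_Mapping.single m c * mpartial i (Poly_Mapping.single m' d)"
proof -
  let ?s = "Poly_Mapping.single i (1::nat)"
  have shift: "m - ?s + m' = m + m' - ?s" if "Poly_Mapping.lookup m i > 0" for m m' :: "'a \<Rightarrow>\<^sub>0 nat"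
    using that by (intro poly_mapping_eqI) (auto simp: lookup_add lookup_minus lookup_single when_def)
  have 1: "Poly_Mapping.single (m - ?s + m') (of_nat (Poly_Mapping.lookup m i) * c * d) =
        Poly_Mapping.single (m + m' - ?s) (of_nat (Poly_Mapping.lookup m i) * c * d)"
    using shift[of m m'] by (cases "Poly_Mapping.lookup m i > 0") auto
  have 2: "Poly_Mapping.single (m + (m' - ?s)) (c * (of_nat (Poly_Mapping.lookup m' i) * d)) =
        Poly_Mapping.single (m + m' - ?s) (c * (of_nat (Poly_Mapping.lookup m' i) * d))"
    using shift[of m' m] by (cases "Poly_Mapping.lookup m' i > 0") (auto simp: add.commute)
  show ?thesis
    by (simp only: mpartial_single mult_single 1 2)
      (simp add: lookup_add algebra_simps flip: single_add)
qed

lemma mpartial_mult: "mpartial i (p * q) = mpartial i p * q + p * mpartial i q"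
proof (induction p rule: mpoly_induct)
  case zero
  then show ?case by simp
next
  case (add p m c)
  have "mpartial i (Poly_Mapping.single m c * q) =
    mpartial i (Poly_Mapping.single m c) * q + Poly_Mapping.single m c * mpartial i q"
  proof (induction q rule: mpoly_induct)
    case zero
    then show ?case by simp
  next
    case (add q m' d)
    then show ?case by (simp add: distrib_left mpartial_add mpartial_mult_single)
  qed
  with add show ?case by (simp add: distrib_right mpartial_add)
qed

lemma linear_mscale_iff:
  "Vector_Spaces.linear mscale mscale D \<longleftrightarrow>
     (\<forall>p q. D (p + q) = D p + D q) \<and> (\<forall>c p. D (mscale c p) = mscale c (D p))"
  unfolding linear_iff_module_hom module_hom_def module_hom_axioms_def
  by (simp add: mpoly.module_axioms)

lemma triangular_imp_Der:
  assumes "triangular D"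
  shows "D \<in> Der"
proof -
  obtain g where D: "D = (\<lambda>p. \<Sum>i\<in>UNIV. g i * mpartial i p)"
    using assms by (auto simp: triangular_def)
  show ?thesis
    unfolding D Der_def linear_mscale_iff mscale_def
    by (auto simp: mpartial_add mpartial_mult mpartial_single algebra_simps sum.distrib sum_distrib_left)
qed

lemma Der_diff:
  assumes "D \<in> Der"
  shows "D (p - q) = D p - D q"
proof -
  have "D ((p - q) + q) = D (p - q) + D q"
    using assms unfolding Der_def linear_mscale_iff by blast
  then show ?thesis by simp
qed

lemma Der_zero:
  assumes "D \<in> Der"
  shows "D 0 = 0"
  using Der_diff[OF assms, of 0 0] by simp

lemma lie_subalgebra_Der: "lie_subalgebra (Der :: (('n, 'k::field) mpoly \<Rightarrow> ('n, 'k) mpoly) set)"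
proof -
  have "lie_bracket D E \<in> Der" if D: "D \<in> Der" and E: "E \<in> Der"
    for D E :: "('n, 'k) mpoly \<Rightarrow> ('n, 'k) mpoly"
  proof -
    have add: "F (p + q) = F p + F q" and scale: "F (mscale c p) = mscale c (F p)"
      and mult: "F (p * q) = F p * q + p * F q" if "F \<in> Der"
      for F :: "('n, 'k) mpoly \<Rightarrow> ('n, 'k) mpoly" and p q c
      using that by (auto simp: Der_def linear_mscale_iff)
    show ?thesis
      unfolding Der_def linear_mscale_iff
      by (auto simp: lie_bracket_def add[OF D] add[OF E] scale[OF D] scale[OF E] mult[OF D]
          mult[OF E] mpoly.scale_right_diff_distrib algebra_simps)
  qed
  moreover have "der.subspace (Der :: (('n, 'k) mpoly \<Rightarrow> ('n, 'k) mpoly) set)"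
    unfolding der.subspace_def Der_def linear_mscale_iff
    by (auto simp: der_scale_def mscale_def distrib_left distrib_right add_ac mult_ac)
  ultimately show ?thesis
    by (simp add: lie_subalgebra_def)
qed

lemma lie_subalgebra_lie_generated:
  assumes "S \<subseteq> Der"
  shows "lie_subalgebra (lie_generated S)"
proof -
  have "lie_generated S \<subseteq> Der"
    unfolding lie_generated_def using assms lie_subalgebra_Der by (rule hull_minimal)
  moreover have "der.subspace (lie_generated S)"
    unfolding lie_generated_def hull_def
    by (rule der.subspace_Inter) (simp add: lie_subalgebra_def)
  moreover have "lie_bracket D E \<in> lie_generated S"
    if "D \<in> lie_generated S" "E \<in> lie_generated S" for D E
    using that by (simp add: lie_generated_def hull_def lie_subalgebra_def)
  ultimately show ?thesis
    by (simp add: lie_subalgebra_def)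
qed

end

theory Submission
  imports Defs
begin

text \<open>
  Give \<open>x\<^sub>i\<close> a weight \<open>w i\<close> that grows so fast with \<open>i\<close> that every monomial in the coefficient of
  \<open>\<partial>/\<partial>x\<^sub>i\<close> in any of the finitely many generators has weight less than \<open>w i\<close>. Then all generators
  lower the weight of polynomials by at least 1, hence so does the Lie algebra \<open>L\<close> they generate, and
  the \<open>k\<close>-th term of its lower central series lowers weights by at least \<open>k + 1\<close>. A derivation is
  determined by its values on the variables, and these are polynomials of weight below the maximum
  of \<open>w\<close>: this bounds the dimension of \<open>L\<close> and kills the lower central series.
\<close>

section \<open>Derivations\<close>

lemma keys_sum_subset: "Poly_Mapping.keys (sum f A) \<subseteq> (\<Union>a\<in>A. Poly_Mapping.keys (f a))"
proof (induction A rule: infinite_finite_induct)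
  case (insert a A)
  then show ?case using keys_add[of "f a" "sum f A"] by auto
qed auto

text \<open>The additive form avoids truncated subtraction: a monomial without \<open>x_i\<close>
  contributes the coefficient 0, so every surviving \<open>m'\<close> arises by genuinely removing
  one \<open>i\<close>.\<close>

lemma keys_mpartial:
  assumes "m' \<in> Poly_Mapping.keys (mpartial i p)"
  obtains m where "m \<in> Poly_Mapping.keys p" "m = m' + Poly_Mapping.single i 1"
proof -
  let ?f = "\<lambda>m. Poly_Mapping.single (m - Poly_Mapping.single i 1)
      (of_nat (Poly_Mapping.lookup m i) * Poly_Mapping.lookup p m)"
  have "m' \<in> (\<Union>m\<in>Poly_Mapping.keys p. Poly_Mapping.keys (?f m))"
    using assms unfolding mpartial_def by (rule subsetD[OF keys_sum_subset])
  then obtain m where m: "m \<in> Poly_Mapping.keys p" and "m' \<in> Poly_Mapping.keys (?f m)"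
    by (elim UN_E)
  then have m': "m' = m - Poly_Mapping.single i 1" and "Poly_Mapping.lookup m i \<noteq> 0"
    by (cases "Poly_Mapping.lookup m i = 0"; simp split: if_splits)+
  then have "m = m' + Poly_Mapping.single i 1"
    by (intro poly_mapping_eqI) (auto simp: lookup_add lookup_minus lookup_single when_def)
  with m show thesis by (rule that)
qed

lemma sum_mpartial_in_Der:
  fixes g :: "'n::finite \<Rightarrow> ('n, 'k::field) mpoly"
  shows "(\<lambda>p. \<Sum>i\<in>UNIV. g i * mpartial i p) \<in> Der"
  unfolding Der_def linear_mscale_iff mscale_def
  by (auto simp: mpartial_add mpartial_mult mpartial_single algebra_simps sum.distrib sum_distrib_left)

lemma sum_fun_apply: "sum f A x = (\<Sum>a\<in>A. f a x)"
  by (induction A rule: infinite_finite_induct) auto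

lemma Der_add: "D \<in> Der \<Longrightarrow> D (p + q) = D p + D q"
  and Der_scale: "D \<in> Der \<Longrightarrow> D (mscale c p) = mscale c (D p)"
  and Der_mult: "D \<in> Der \<Longrightarrow> D (p * q) = D p * q + p * D q"
  by (auto simp: Der_def linear_mscale_iff)

text \<open>By the Leibniz rule and linearity the kernel of a derivation is a subalgebra; once it
  contains the variables it is everything.\<close>

lemma Der_eq_zeroI:
  fixes D :: "('n, 'k::field) mpoly \<Rightarrow> ('n, 'k) mpoly"
  assumes D: "D \<in> Der" and var: "\<And>i. D (mvar i) = 0"
  shows "D = 0"
proof -
  \<comment> \<open>Leibniz on \<open>1 * 1\<close> gives \<open>D 1 = D 1 + D 1\<close>.\<close>
  have one: "D 1 = 0"
    using Der_mult[OF D, of 1 1] by (simp add: single_one)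
  have plus: "D (Poly_Mapping.single (m + m') 1) = 0"
    if "D (Poly_Mapping.single m 1) = 0" "D (Poly_Mapping.single m' 1) = 0" for m m'
    using Der_mult[OF D, of "Poly_Mapping.single m 1" "Poly_Mapping.single m' 1"] that
    by (simp add: mult_single)
  have pow: "D (Poly_Mapping.single (Poly_Mapping.single i b) 1) = 0" for i b
  proof (induction b)
    case (Suc b)
    then show ?case
      using plus[of "Poly_Mapping.single i b" "Poly_Mapping.single i 1"] var[of i]
      by (simp add: mvar_def flip: single_add)
  qed (simp add: one)
  have monom: "D (Poly_Mapping.single m 1) = 0" for m
  proof (induction m rule: update_induct)
    case (update f a b)
    have "Poly_Mapping.update a b f = f + Poly_Mapping.single a b"
      using update
      by (intro poly_mapping_eqI) (auto simp: lookup_update lookup_add lookup_single in_keys_iff when_def)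
    with update plus pow show ?case by simp
  qed (simp add: one)
  have "D p = 0" for p
  proof (induction p rule: mpoly_induct)
    case (add p m c)
    have "Poly_Mapping.single m c = mscale c (Poly_Mapping.single m 1)"
      by (simp add: mscale_def mult_single)
    with add show ?case by (simp add: Der_add[OF D] Der_scale[OF D] monom)
  qed (rule Der_zero[OF D])
  then show ?thesis by auto
qed

text \<open>Both sides are derivations that agree on the variables, so their difference
  vanishes.\<close>

lemma Der_eq_sum_mpartial:
  fixes D :: "('n::finite, 'k::field) mpoly \<Rightarrow> ('n, 'k) mpoly"
  assumes D: "D \<in> Der"
  shows "D = (\<lambda>p. \<Sum>i\<in>UNIV. D (mvar i) * mpartial i p)" (is "D = ?E")
proof -
  have "D - ?E \<in> Der"
  proof (rule der.subspace_diff)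
    show "der.subspace (Der :: (('n, 'k) mpoly \<Rightarrow> ('n, 'k) mpoly) set)"
      using lie_subalgebra_Der unfolding lie_subalgebra_def by (elim conjE)
  qed (rule D, rule sum_mpartial_in_Der)
  moreover have "(D - ?E) (mvar j) = 0" for j
    by (simp add: mpartial_mvar if_distrib cong: if_cong)
  ultimately have "D - ?E = 0" by (rule Der_eq_zeroI)
  then show ?thesis by simp
qed

section \<open>The weight filtration\<close>

definition weight :: "('n::finite \<Rightarrow> nat) \<Rightarrow> ('n \<Rightarrow>\<^sub>0 nat) \<Rightarrow> nat" where
  "weight w m = (\<Sum>i\<in>UNIV. Poly_Mapping.lookup m i * w i)"

text \<open>The bound is an integer so that it may drop below 0, where only the zero polynomial
  remains.\<close>

definition polys_le :: "('n::finite \<Rightarrow> nat) \<Rightarrow> int \<Rightarrow> ('n, 'k::zero) mpoly set" where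
  "polys_le w d = {p. \<forall>m\<in>Poly_Mapping.keys p. int (weight w m) \<le> d}"

definition lowering :: "('n::finite \<Rightarrow> nat) \<Rightarrow> nat \<Rightarrow> (('n, 'k::field) mpoly \<Rightarrow> ('n, 'k) mpoly) set" where
  "lowering w k = {D \<in> Der. \<forall>d. \<forall>p\<in>polys_le w d. D p \<in> polys_le w (d - int k)}"

lemma weight_add: "weight w (m + m') = weight w m + weight w m'"
  by (simp add: weight_def lookup_add distrib_right sum.distrib)

lemma weight_single: "weight w (Poly_Mapping.single i a) = a * w i"
  by (simp add: weight_def lookup_single when_def if_distrib if_distribR cong: if_cong)

text \<open>Positive weights bound each exponent by \<open>d\<close>, and there are finitely many
  variables.\<close>

lemma finite_weight_le:
  assumes "\<And>i. 0 < w i"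
  shows "finite {m. weight w m \<le> d}"
proof (rule finite_imageD)
  have "Poly_Mapping.lookup m i \<le> d" if "weight w m \<le> d" for m i
  proof -
    have "Poly_Mapping.lookup m i \<le> Poly_Mapping.lookup m i * w i"
      using assms[of i] by (cases "w i") auto
    also have "\<dots> \<le> weight w m"
      unfolding weight_def by (rule member_le_sum) auto
    finally show ?thesis using that by simp
  qed
  then have "Poly_Mapping.lookup ` {m. weight w m \<le> d} \<subseteq> {f. range f \<subseteq> {..d}}"
    by auto
  moreover have "finite {f :: 'a \<Rightarrow> nat. range f \<subseteq> {..d}}"
    using finite_set_of_finite_funs[of "UNIV :: 'a set" "{..d}" 0]
    by (simp add: image_subset_iff)
  ultimately show "finite (Poly_Mapping.lookup ` {m. weight w m \<le> d})"
    by (rule finite_subset)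
qed (auto intro!: inj_onI poly_mapping_eqI)

lemma polys_le_zero: "0 \<in> polys_le w d"
  by (simp add: polys_le_def)

lemma polys_le_neg: "p \<in> polys_le w d \<Longrightarrow> d < 0 \<Longrightarrow> p = 0"
  by (force simp: polys_le_def simp flip: keys_eq_empty)

lemma polys_le_add: "p \<in> polys_le w d \<Longrightarrow> q \<in> polys_le w d \<Longrightarrow> p + q \<in> polys_le w d"
  using keys_add[of p q] by (auto simp: polys_le_def)

lemma polys_le_sum: "(\<And>a. a \<in> A \<Longrightarrow> f a \<in> polys_le w d) \<Longrightarrow> sum f A \<in> polys_le w d"
  using keys_sum_subset[of f A] by (fastforce simp: polys_le_def)

lemma polys_le_mult:
  assumes "p \<in> polys_le w d" "q \<in> polys_le w e"
  shows "p * q \<in> polys_le w (d + e)"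
  unfolding polys_le_def
proof (intro CollectI ballI)
  fix m assume "m \<in> Poly_Mapping.keys (p * q)"
  then obtain a b where "m = a + b" "a \<in> Poly_Mapping.keys p" "b \<in> Poly_Mapping.keys q"
    using keys_mult[of p q] by auto
  with assms show "int (weight w m) \<le> d + e"
    by (force simp: polys_le_def weight_add)
qed

lemma polys_le_scale:
  assumes "p \<in> polys_le w d"
  shows "mscale c p \<in> polys_le w d"
proof -
  have "Poly_Mapping.single 0 c \<in> polys_le w 0"
    by (simp add: polys_le_def weight_def)
  from polys_le_mult[OF this assms] show ?thesis by (simp add: mscale_def)
qed

lemma polys_le_diff:
  fixes p q :: "('n::finite, 'k::field) mpoly"
  assumes "p \<in> polys_le w d" "q \<in> polys_le w d"
  shows "p - q \<in> polys_le w d"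
  using polys_le_add[OF assms(1) polys_le_scale[OF assms(2), of "-1"]] by simp

lemma polys_le_mvar: "mvar i \<in> polys_le w (int (w i))"
  by (simp add: polys_le_def mvar_def weight_single)

lemma polys_le_mpartial:
  "p \<in> polys_le w d \<Longrightarrow> mpartial i p \<in> polys_le w (d - int (w i))"
  by (fastforce simp: polys_le_def weight_add weight_single elim: keys_mpartial)

lemma subspace_lowering: "der.subspace (lowering w k)"
proof -
  have "der.subspace Der"
    using lie_subalgebra_Der by (auto simp: lie_subalgebra_def)
  then show ?thesis
    by (auto simp: lowering_def der.subspace_def der_scale_def polys_le_zero polys_le_add polys_le_scale)
qed

text \<open>Both compositions lower the weight by \<open>j + k\<close>. This gives closure under
  brackets as well as the descent of the lower central series.\<close>

lemma lie_bracket_lowering: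
  assumes D: "D \<in> lowering w j" and E: "E \<in> lowering w k"
  shows "lie_bracket D E \<in> lowering w (j + k)"
proof -
  have "lie_bracket D E \<in> Der"
    using lie_subalgebra_Der D E by (auto simp: lie_subalgebra_def lowering_def)
  moreover have "lie_bracket D E p \<in> polys_le w (d - int (j + k))" if "p \<in> polys_le w d" for p d
  proof -
    have "D (E p) \<in> polys_le w (d - int k - int j)" "E (D p) \<in> polys_le w (d - int j - int k)"
      using D E that by (auto simp: lowering_def)
    then show ?thesis
      by (simp add: lie_bracket_def polys_le_diff algebra_simps)
  qed
  ultimately show ?thesis by (simp add: lowering_def)
qed

lemma lowering_antimono: "j \<le> k \<Longrightarrow> lowering w k \<subseteq> lowering w j"
  by (fastforce simp: lowering_def polys_le_def)

lemma lie_subalgebra_lowering: "lie_subalgebra (lowering w k)"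
  unfolding lie_subalgebra_def
proof (intro conjI ballI subspace_lowering)
  show "lie_bracket D E \<in> lowering w k" if "D \<in> lowering w k" "E \<in> lowering w k" for D E
    using lie_bracket_lowering[OF that] lowering_antimono[of k "k + k" w] by auto
qed (auto simp: lowering_def)

section \<open>Vanishing, finite dimension and nilpotency from lowering\<close>

text \<open>Each variable \<open>x_i\<close> has weight \<open>w i < k\<close>, so its image has a
  negative weight bound.\<close>

lemma lowering_eq_zero:
  assumes "D \<in> lowering w k" "\<And>i. w i < k"
  shows "D = 0"
proof (rule Der_eq_zeroI)
  show "D (mvar i) = 0" for i
  proof (rule polys_le_neg)
    show "D (mvar i) \<in> polys_le w (int (w i) - int k)"
      using assms(1) polys_le_mvar by (auto simp: lowering_def)
    show "int (w i) - int k < 0" using assms(2)[of i] by simp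
  qed
qed (use assms in \<open>simp add: lowering_def\<close>)

lemma lowering_finite_span:
  fixes w :: "'n::finite \<Rightarrow> nat"
  assumes pos: "\<And>i. 0 < w i"
  obtains B :: "(('n, 'k::field) mpoly \<Rightarrow> ('n, 'k) mpoly) set"
    where "finite B" "lowering w k \<subseteq> der.span B"
proof
  \<comment> \<open>The monomial derivations \<open>x^m * d/dx_i\<close>. Since
    \<open>D (mvar i)\<close> has weight at most \<open>w i - k\<close>, those with
    \<open>weight w m \<le> w i\<close> suffice for every \<open>k\<close>.\<close>
  define b :: "'n \<Rightarrow> ('n \<Rightarrow>\<^sub>0 nat) \<Rightarrow> ('n, 'k) mpoly \<Rightarrow> ('n, 'k) mpoly" where
    "b i m = (\<lambda>p. Poly_Mapping.single m 1 * mpartial i p)" for i m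
  let ?B = "\<Union>i. b i ` {m. weight w m \<le> w i}"
  show "finite ?B" by (simp add: finite_weight_le pos)
  show "lowering w k \<subseteq> der.span ?B"
  proof
    fix D :: "('n, 'k) mpoly \<Rightarrow> ('n, 'k) mpoly"
    assume D: "D \<in> lowering w k"
    have "(\<lambda>p. D (mvar i) * mpartial i p) \<in> der.span ?B" for i
    proof -
      let ?g = "D (mvar i)"
      let ?c = "Poly_Mapping.lookup ?g"
      have g: "?g = (\<Sum>m\<in>Poly_Mapping.keys ?g. Poly_Mapping.single m (?c m))"
        by (intro poly_mapping_eqI) (simp add: lookup_sum lookup_single when_def in_keys_iff)
      have "?g * mpartial i p = (\<Sum>m\<in>Poly_Mapping.keys ?g. der_scale (?c m) (b i m)) p" for p
      proof -
        have "?g * mpartial i p =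
            (\<Sum>m\<in>Poly_Mapping.keys ?g. Poly_Mapping.single m (?c m)) * mpartial i p"
          using g by (rule arg_cong)
        also have "\<dots> = (\<Sum>m\<in>Poly_Mapping.keys ?g. der_scale (?c m) (b i m)) p"
          by (simp add: sum_fun_apply sum_distrib_right der_scale_def b_def mscale_def mult_single
              flip: mult.assoc)
        finally show ?thesis .
      qed
      then have "(\<lambda>p. ?g * mpartial i p) = (\<Sum>m\<in>Poly_Mapping.keys ?g. der_scale (?c m) (b i m))"
        by (rule ext)
      moreover have "b i m \<in> ?B" if "m \<in> Poly_Mapping.keys ?g" for m
      proof -
        have "?g \<in> polys_le w (int (w i) - int k)"
          using D polys_le_mvar by (auto simp: lowering_def)
        with that have "weight w m \<le> w i" by (force simp: polys_le_def)
        then show ?thesis by blast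
      qed
      ultimately show ?thesis
        by (simp only: der.span_sum der.span_scale der.span_base)
    qed
    then have "(\<Sum>i\<in>UNIV. (\<lambda>p. D (mvar i) * mpartial i p)) \<in> der.span ?B"
      by (rule der.span_sum)
    also have "(\<Sum>i\<in>UNIV. (\<lambda>p. D (mvar i) * mpartial i p)) =
        (\<lambda>p. \<Sum>i\<in>UNIV. D (mvar i) * mpartial i p)"
      by (simp add: fun_eq_iff sum_fun_apply)
    also have "\<dots> = D"
      using D by (intro Der_eq_sum_mpartial[symmetric]) (simp add: lowering_def)
    finally show "D \<in> der.span ?B" .
  qed
qed

text \<open>\<open>lie_finite_dim\<close> asks for a spanning set inside \<open>L\<close>, while
  \<open>B\<close> may lie outside. A basis of \<open>L\<close> is independent in the span of
  \<open>B\<close>, hence finite.\<close>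

lemma lie_finite_dim_subspace:
  assumes L: "der.subspace L" and "finite B" "L \<subseteq> der.span B"
  shows "lie_finite_dim L"
proof -
  obtain C where C: "C \<subseteq> L" "der.independent C" "L \<subseteq> der.span C"
    by (rule der.maximal_independent_subset)
  have "C \<subseteq> der.span B"
    using C(1) assms(3) by (rule subset_trans)
  with \<open>finite B\<close> C(2) have "finite C"
    by (rule der.independent_span_bound[THEN conjunct1])
  moreover have "der.span C = L"
    using C(1,3) L by (rule der.span_subspace)
  ultimately show ?thesis
    using C(1) unfolding lie_finite_dim_def by iprover
qed

text \<open>Each bracket with an element of \<open>L\<close> lowers the weight by one more; the
  index is shifted because term 0 is \<open>L\<close>, which already lowers by 1.\<close>

lemma lower_central_lowering:
  assumes "L \<subseteq> lowering w 1"
  shows "lower_central L k \<subseteq> lowering w (Suc k)"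
proof (induction k)
  case (Suc k)
  then have "{lie_bracket D E |D E. D \<in> L \<and> E \<in> lower_central L k} \<subseteq> lowering w (Suc (Suc k))"
    using assms lie_bracket_lowering[of _ w 1 _ "Suc k"] by auto
  then show ?case
    by (simp add: der.span_minimal subspace_lowering)
qed (use assms in simp)

lemma lie_nilpotent_lowering:
  fixes L :: "(('n::finite, 'k::field) mpoly \<Rightarrow> ('n, 'k) mpoly) set"
  assumes L: "der.subspace L" "L \<subseteq> lowering w 1"
  shows "lie_nilpotent L"
proof -
  let ?k = "Max (range w)"
  have "D = 0" if "D \<in> lower_central L ?k" for D
    using lower_central_lowering[OF L(2)] that
    by (intro lowering_eq_zero[of D w "Suc ?k"]) (auto simp: less_Suc_eq_le)
  \<comment> \<open>Needed for equality with \<open>{0}\<close>: term 0 is the subspace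
    \<open>L\<close>, every later term is a span.\<close>
  moreover have "0 \<in> lower_central L ?k"
    using L(1) by (cases ?k) (simp_all add: der.subspace_0 der.span_zero)
  ultimately show ?thesis
    unfolding lie_nilpotent_def by blast
qed

section \<open>Weights adapted to triangular derivations\<close>

text \<open>Take powers of \<open>N + 1\<close>, where \<open>N\<close> bounds the total degrees. A
  monomial in \<open>M i\<close> has at most \<open>N\<close> factors, all of them variables before
  \<open>i\<close> with weight at most \<open>w i / (N + 1)\<close>, so its weight is below
  \<open>w i\<close>.\<close>

lemma dominating_weights:
  fixes M :: "'n::{finite,linorder} \<Rightarrow> ('n \<Rightarrow>\<^sub>0 nat) set"
  assumes fin: "\<And>i. finite (M i)" and keys: "\<And>i m. m \<in> M i \<Longrightarrow> Poly_Mapping.keys m \<subseteq> {..<i}"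
  obtains w :: "'n \<Rightarrow> nat" where "\<And>i. 0 < w i" "\<And>i m. m \<in> M i \<Longrightarrow> weight w m < w i"
proof
  \<comment> \<open>With all weights 1, \<open>weight\<close> is the total degree; inserting 0
    covers the case that all \<open>M i\<close> are empty.\<close>
  define N where "N = Max (insert 0 (weight (\<lambda>_. 1) ` (\<Union>i. M i)))"
  \<comment> \<open>The exponent is the position of \<open>i\<close> in the order, counted from
    0.\<close>
  let ?w = "\<lambda>i::'n. Suc N ^ card {..<i}"
  show pos: "0 < ?w i" for i by simp
  show "weight ?w m < ?w i" if m: "m \<in> M i" for i m
  proof -
    have step: "Suc N * ?w j \<le> ?w i" if "j < i" for j
    proof -
      have "{..<j} \<subset> {..<i}" using that by auto
      then have "card {..<j} < card {..<i}" by (intro psubset_card_mono) auto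
      then have "Suc N ^ Suc (card {..<j}) \<le> ?w i" by (intro power_increasing) auto
      then show ?thesis by simp
    qed
    \<comment> \<open>The claim is proved after multiplication by \<open>Suc N\<close>, which
      replaces the division by \<open>N + 1\<close>.\<close>
    have "Suc N * weight ?w m = (\<Sum>j\<in>UNIV. Poly_Mapping.lookup m j * (Suc N * ?w j))"
      unfolding weight_def sum_distrib_left by (simp only: mult.left_commute)
    also have "\<dots> \<le> (\<Sum>j\<in>UNIV. Poly_Mapping.lookup m j * ?w i)"
    proof (rule sum_mono)
      fix j
      show "Poly_Mapping.lookup m j * (Suc N * ?w j) \<le> Poly_Mapping.lookup m j * ?w i"
      proof (cases "j < i")
        case False
        with keys[OF m] have "Poly_Mapping.lookup m j = 0" by (auto simp: in_keys_iff)
        then show ?thesis by simp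
      qed (intro mult_left_mono step, auto)
    qed
    also have "\<dots> = weight (\<lambda>_. 1) m * ?w i"
      by (simp add: weight_def sum_distrib_right)
    also have "\<dots> \<le> N * ?w i"
      unfolding N_def using m fin by (intro mult_right_mono Max_ge) auto
    also have "\<dots> < Suc N * ?w i" using pos by simp
    finally show ?thesis by (simp only: mult_less_cancel1)
  qed
qed

text \<open>The partial derivative lowers the weight by \<open>w i\<close>, and multiplying by
  \<open>g i\<close> restores at most \<open>w i - 1\<close> of it.\<close>

lemma sum_mpartial_lowering:
  fixes g :: "'n::finite \<Rightarrow> ('n, 'k::field) mpoly"
  assumes "\<And>i m. m \<in> Poly_Mapping.keys (g i) \<Longrightarrow> weight w m < w i"
  shows "(\<lambda>p. \<Sum>i\<in>UNIV. g i * mpartial i p) \<in> lowering w 1"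
  unfolding lowering_def
proof (intro CollectI conjI allI ballI sum_mpartial_in_Der polys_le_sum)
  fix d p i
  assume p: "p \<in> (polys_le w d :: ('n, 'k) mpoly set)"
  have "g i \<in> polys_le w (int (w i) - 1)"
    using assms[of _ i] by (force simp: polys_le_def)
  from polys_le_mult[OF this polys_le_mpartial[OF p, of i]]
  show "g i * mpartial i p \<in> polys_le w (d - int 1)" by simp
qed

theorem corollary2:
  fixes D :: "nat \<Rightarrow>
      ('n::{finite,linorder}, 'k::{alg_closed_field,field_char_0}) mpoly \<Rightarrow> ('n, 'k) mpoly"
    and s :: nat
  assumes "\<And>j. j \<in> {1..s} \<Longrightarrow> triangular (D j)"
  shows "lie_finite_dim (lie_generated (D ` {1..s})) \<and> lie_nilpotent (lie_generated (D ` {1..s}))"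
proof -
  let ?L = "lie_generated (D ` {1..s})"
  have "\<forall>j\<in>{1..s}. \<exists>g. (\<forall>i. g i \<in> polys_in {..<i}) \<and> D j = (\<lambda>p. \<Sum>i\<in>UNIV. g i * mpartial i p)"
    using assms by (simp add: triangular_def)
  then obtain g where "\<forall>j\<in>{1..s}. (\<forall>i. g j i \<in> polys_in {..<i}) \<and>
      D j = (\<lambda>p. \<Sum>i\<in>UNIV. g j i * mpartial i p)"
    by (rule bchoice[THEN exE])
  then have g: "\<And>j i. j \<in> {1..s} \<Longrightarrow> g j i \<in> polys_in {..<i}"
    and D: "\<And>j. j \<in> {1..s} \<Longrightarrow> D j = (\<lambda>p. \<Sum>i\<in>UNIV. g j i * mpartial i p)"
    by simp_all
  \<comment> \<open>Pooling the monomials of all generators yields one weight for all of them; the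
    pool is finite because there are finitely many generators.\<close>
  let ?M = "\<lambda>i. \<Union>j\<in>{1..s}. Poly_Mapping.keys (g j i)"
  have fin: "finite (?M i)" for i
    by simp
  have keys: "Poly_Mapping.keys m \<subseteq> {..<i}" if "m \<in> ?M i" for i m
    using that g by (fastforce simp: polys_in_def)
  obtain w :: "'n \<Rightarrow> nat" where pos: "\<And>i. 0 < w i"
    and w: "\<And>i m. m \<in> ?M i \<Longrightarrow> weight w m < w i"
    using dominating_weights[of ?M, OF fin keys] by blast
  have "D j \<in> lowering w 1" if "j \<in> {1..s}" for j
    unfolding D[OF that] by (rule sum_mpartial_lowering) (use that w in blast)
  \<comment> \<open>\<open>lowering w 1\<close> is itself a Lie subalgebra containing the
    generators, so it contains the hull.\<close>
  then have L: "?L \<subseteq> lowering w 1"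
    unfolding lie_generated_def
    by (intro hull_minimal image_subsetI) (auto simp: lie_subalgebra_lowering)
  have "D ` {1..s} \<subseteq> Der"
    using assms triangular_imp_Der by blast
  then have sub: "der.subspace ?L"
    using lie_subalgebra_lie_generated by (auto simp: lie_subalgebra_def)
  obtain B :: "(('n, 'k) mpoly \<Rightarrow> ('n, 'k) mpoly) set"
    where "finite B" "lowering w 1 \<subseteq> der.span B"
    using pos by (rule lowering_finite_span)
  with L have "lie_finite_dim ?L"
    by (intro lie_finite_dim_subspace[OF sub]) auto
  moreover have "lie_nilpotent ?L"
    using sub L by (rule lie_nilpotent_lowering)
  ultimately show ?thesis ..
qed

end
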